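(* Let $A\subset\mathbf{E}^d$ and $R>0$. If $\mathrm{reach}(A'_R)\ge R$, then $A$ admits an $R$-hull $\hat A$, and $$\hat A=(A'_R)'_R.$$
   Context: $\mathbf{E}^d$ is $d$-dimensional Euclidean space, with norm $\|\cdot\|$. $B(x,r)$ denotes the open ball with center $x$ and radius $r>0$. For $A\subset\mathbf{E}^d$, $\delta_A(a)=\inf\{\|a-x\|: x\in A\}$ is the distance from $a$ to $A$ (with $\delta_\emptyset\equiv+\infty$). For a closed set $K\subset\mathbf{E}^d$, $\mathrm{Unp}(K)$ is the set of points $a\in\mathbf{E}^d$ for which there is a unique $x\in K$ with $\delta_K(a)=\|a-x\|$. For $a\in K$, $\mathrm{reach}(K,a)=\sup\{r>0: B(a,r)\subset\mathrm{Unp}(K)\}$ (with value $0$ if there is no such $r$), and $\mathrm{reach}(K)=\inf_{a\in K}\mathrm{reach}(K,a)\in[0,\infty]$, with the convention $\inf\emptyset=+\infty$. Reach is defined only for closed sets, so an assertion $\mathrm{reach}(K)\ge R$ includes that $K$ is closed. For any $A\subset\mathbf{E}^d$ and $R>0$, $A'_R=\{x\in\mathbf{E}^d: \delta_A(x)\ge R\}$; $(A'_R)'_R$ is the result of applying this operation twice. A set $A\subset\mathbf{E}^d$ admits an $R$-hull if there exists $\hat A\subset\mathbf{E}^d$ such that: (i) $A\subset\hat A$; (ii) $\mathrm{reach}(\hat A)\ge R$; (iii) whenever $\mathrm{reach}(K)\ge R$ and $A\subset K$, one has $\hat A\subset K$. Such a set $\hat A$ (necessarily unique) is called the $R$-hull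 of $A$. *)

theory Defs
  imports "HOL-Analysis.Analysis"
begin

text \<open>
  Distances and reaches take values in \<^typ>\<open>ennreal\<close>, i.e. in \<open>[0, \<infinity>]\<close>, because there
  \<open>Inf {} = \<infinity>\<close> and \<open>Sup {} = 0\<close>, which are exactly the conventions for the distance to the
  empty set, for the reach of the empty set, and for points around which no ball has unique
  nearest points. The library function \<open>infdist\<close> is not suitable: it is \<open>0\<close> for the empty set.
\<close>

definition set_distance :: "'a::euclidean_space set \<Rightarrow> 'a \<Rightarrow> ennreal" where
  "set_distance A a = (INF x\<in>A. ennreal (norm (a - x)))"

definition Unp :: "'a::euclidean_space set \<Rightarrow> 'a set" where
  "Unp K = {a. \<exists>!x. x \<in> K \<and> set_distance K a = ennreal (norm (a - x))}"

definition reach_at :: "'a::euclidean_space set \<Rightarrow> 'a \<Rightarrow> ennreal" where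
  "reach_at K a = Sup {ennreal r |r. r > 0 \<and> ball a r \<subseteq> Unp K}"

definition reach :: "'a::euclidean_space set \<Rightarrow> ennreal" where
  "reach K = (INF a\<in>K. reach_at K a)"

text \<open>The notion of reach is only meaningful for closed sets, so a lower bound on the reach
  includes closedness.\<close>

definition reach_at_least :: "real \<Rightarrow> 'a::euclidean_space set \<Rightarrow> bool" where
  "reach_at_least R K \<longleftrightarrow> closed K \<and> reach K \<ge> ennreal R"

text \<open>\<open>far_set R A\<close> is the set written \<open>A'\<close> with subscript \<open>R\<close>.\<close>

definition far_set :: "real \<Rightarrow> 'a::euclidean_space set \<Rightarrow> 'a set" where
  "far_set R A = {x. set_distance A x \<ge> ennreal R}"

definition is_R_hull :: "real \<Rightarrow> 'a::euclidean_space set \<Rightarrow> 'a set \<Rightarrow> bool" where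
  "is_R_hull R A H \<longleftrightarrow>
     A \<subseteq> H \<and> reach_at_least R H \<and> (\<forall>K. reach_at_least R K \<and> A \<subseteq> K \<longrightarrow> H \<subseteq> K)"

definition admits_R_hull :: "real \<Rightarrow> 'a::euclidean_space set \<Rightarrow> bool" where
  "admits_R_hull R A \<longleftrightarrow> (\<exists>H. is_R_hull R A H)"

definition R_hull :: "real \<Rightarrow> 'a::euclidean_space set \<Rightarrow> 'a set" where
  "R_hull R A = (THE H. is_R_hull R A H)"

lemma is_R_hull_unique:
  assumes "is_R_hull R A H" and "is_R_hull R A H'"
  shows "H = H'"
  using assms unfolding is_R_hull_def by blast

lemma R_hull_eqI: "is_R_hull R A H \<Longrightarrow> R_hull R A = H"
  unfolding R_hull_def by (rule the_equality) (auto dest: is_R_hull_unique)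

end

theory Submission
  imports Defs
begin

text \<open>
  Let \<open>K = far_set R A\<close>. If \<open>reach K \<ge> R\<close> and \<open>p\<close> is the point of \<open>K\<close> nearest to some
  \<open>x \<notin> K\<close>, then by Federer \<open>p\<close> stays nearest along the whole segment of length \<open>R\<close> that starts
  at \<open>p\<close> and points towards \<open>x\<close>. If \<open>dist x p < R\<close>, the endpoint of that segment lies in
  \<open>far_set R K\<close>, and it is the unique point of \<open>far_set R K\<close> nearest to \<open>x\<close>. As balls of radius
  \<open>R\<close> about points of \<open>far_set R K\<close> miss \<open>K\<close>, this gives \<open>reach (far_set R K) \<ge> R\<close>.
  The same endpoint shows \<open>far_set R (far_set R L) \<subseteq> L\<close> whenever \<open>reach L \<ge> R\<close>, and minimality
  follows since \<open>far_set R\<close> is antitone.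
\<close>

section \<open>Far sets, nearest points and reach in terms of real distances\<close>

definition nearest :: "'a::euclidean_space set \<Rightarrow> 'a \<Rightarrow> 'a \<Rightarrow> bool" where
  "nearest K x p \<longleftrightarrow> p \<in> K \<and> (\<forall>k\<in>K. dist x p \<le> dist x k)"

lemma far_set_iff: "x \<in> far_set R A \<longleftrightarrow> (\<forall>a\<in>A. R \<le> dist x a)"
  by (simp add: far_set_def set_distance_def le_INF_iff dist_norm)

lemma far_set_antimono: "A \<subseteq> B \<Longrightarrow> far_set R B \<subseteq> far_set R A"
  by (meson far_set_iff subset_eq)

lemma subset_far_set_far_set: "A \<subseteq> far_set R (far_set R A)"
  by (metis far_set_iff dist_commute subsetI)

lemma closed_far_set: "closed (far_set R A)"
proof -
  have "far_set R A = (\<Inter>a\<in>A. {x. R \<le> dist x a})"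
    by (auto simp: far_set_iff)
  then show ?thesis
    by (auto intro!: closed_INT closed_Collect_le continuous_intros)
qed

text \<open>For \<open>p\<close> in \<open>K\<close> the infimum never exceeds
  \<open>norm (x - p)\<close>, so equality only asks that \<open>norm (x - p)\<close> be a lower
  bound.\<close>

lemma nearest_iff_set_distance:
  "nearest K x p \<longleftrightarrow> p \<in> K \<and> set_distance K x = ennreal (norm (x - p))"
proof (cases "p \<in> K")
  case True
  then have "set_distance K x \<le> ennreal (norm (x - p))"
    unfolding set_distance_def by (rule INF_lower)
  then have "set_distance K x = ennreal (norm (x - p)) \<longleftrightarrow> ennreal (norm (x - p)) \<le> set_distance K x"
    by auto
  also have "\<dots> \<longleftrightarrow> (\<forall>k\<in>K. dist x p \<le> dist x k)"
    by (simp add: set_distance_def le_INF_iff dist_norm)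
  finally show ?thesis
    using True by (simp add: nearest_def)
qed (simp add: nearest_def)

lemma Unp_iff: "x \<in> Unp K \<longleftrightarrow> (\<exists>!p. nearest K x p)"
  by (simp add: Unp_def nearest_iff_set_distance)

text \<open>The supremum in \<open>reach_at\<close> need not be attained, but each point of the open
  ball of radius \<open>R\<close> already lies in some admissible ball.\<close>

lemma reach_at_least_iff:
  assumes "R > 0"
  shows "reach_at_least R K \<longleftrightarrow> closed K \<and> (\<forall>a\<in>K. ball a R \<subseteq> Unp K)"
proof -
  have "ennreal R \<le> reach_at K a \<longleftrightarrow> ball a R \<subseteq> Unp K" for a
  proof
    assume R: "ennreal R \<le> reach_at K a"
    show "ball a R \<subseteq> Unp K"
    proof
      fix x assume "x \<in> ball a R"
      then have "ennreal (dist a x) < ennreal R"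
        by (simp add: ennreal_less_iff)
      then have "ennreal (dist a x) < reach_at K a"
        using R by order
      then obtain r where "ennreal (dist a x) < ennreal r" "ball a r \<subseteq> Unp K"
        unfolding reach_at_def less_Sup_iff by blast
      then show "x \<in> Unp K"
        by (auto simp: ennreal_less_iff)
    qed
  next
    assume "ball a R \<subseteq> Unp K"
    then show "ennreal R \<le> reach_at K a"
      unfolding reach_at_def using assms by (intro Sup_upper) blast
  qed
  then show ?thesis
    by (simp add: reach_at_least_def reach_def le_INF_iff)
qed

section \<open>Stability and continuity of nearest points, and their extension along rays\<close>

lemma nearest_between:
  assumes "nearest K z p" and "dist p z = dist p y + dist y z"
  shows "nearest K y p"
  unfolding nearest_def
proof (intro conjI ballI)
  show "p \<in> K"
    using assms(1) by (simp add: nearest_def)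
next
  fix k assume "k \<in> K"
  then have "dist z p \<le> dist z k"
    using assms(1) by (simp add: nearest_def)
  also have "\<dots> \<le> dist z y + dist y k"
    by (rule dist_triangle)
  finally show "dist y p \<le> dist y k"
    using assms(2) by (simp add: dist_commute)
qed

text \<open>Being nearest is a closed condition on pairs, and uniqueness makes the graph of
  \<open>f\<close> exactly the set of such pairs over \<open>C\<close>. A closed graph with values
  in a compact set gives continuity.\<close>

lemma continuous_on_nearest:
  assumes "closed K" and "compact C" and near: "\<And>z. z \<in> C \<Longrightarrow> nearest K z (f z)"
    and uniq: "C \<subseteq> Unp K"
  shows "continuous_on C f"
proof (cases "C = {}")
  case False
  then obtain c where c: "c \<in> C"
    by blast
  obtain M where M: "\<And>z. z \<in> C \<Longrightarrow> dist c z \<le> M"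
    using compact_imp_bounded[OF \<open>compact C\<close>] unfolding bounded_any_center[where a = c] by blast
  \<comment> \<open>The radius bounds \<open>dist c z + dist z (f z)\<close>, comparing
    \<open>f z\<close> with the competitor \<open>f c\<close>.\<close>
  define T where "T = cball c (2 * M + dist c (f c))"
  have "f \<in> C \<rightarrow> T"
  proof
    fix z assume z: "z \<in> C"
    have "dist c (f z) \<le> dist c z + dist z (f z)"
      by (rule dist_triangle)
    also have "dist z (f z) \<le> dist z (f c)"
      using near[OF z] near[OF c] by (simp add: nearest_def)
    also have "\<dots> \<le> dist c z + dist c (f c)"
      by (metis dist_commute dist_triangle)
    finally show "f z \<in> T"
      using M[OF z] by (simp add: T_def)
  qed
  moreover have "(\<lambda>z. (z, f z)) ` C =
      C \<times> K \<inter> (\<Inter>k\<in>K. {w. dist (fst w) (snd w) \<le> dist (fst w) k})" (is "_ = ?G")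
  proof (intro set_eqI iffI)
    fix w assume "w \<in> (\<lambda>z. (z, f z)) ` C"
    then show "w \<in> ?G"
      using near by (auto simp: nearest_def)
  next
    fix w assume w: "w \<in> ?G"
    then have "nearest K (fst w) (snd w)" "fst w \<in> C"
      by (auto simp: nearest_def)
    then have "snd w = f (fst w)"
      using near uniq unfolding Unp_iff subset_eq by blast
    with \<open>fst w \<in> C\<close> show "w \<in> (\<lambda>z. (z, f z)) ` C"
      by (auto simp: image_iff prod_eq_iff)
  qed
  moreover have "closed ?G"
    using \<open>closed K\<close> compact_imp_closed[OF \<open>compact C\<close>]
    by (intro closed_Int closed_Times closed_INT ballI closed_Collect_le continuous_intros)
  ultimately show ?thesis
    using continuous_from_closed_graph[of T f C] by (simp add: T_def)
qed simp

text \<open>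
  The set of admissible lengths \<open>t\<close> is compact; were its maximum \<open>\<tau>\<close> smaller than \<open>R\<close>, then
  sending \<open>z\<close> near \<open>y = p + \<tau> u\<close> to the point of the sphere about \<open>y\<close> opposite to the nearest
  point of \<open>z\<close> would, by Brouwer, have a fixed point, and \<open>\<tau>\<close> could be enlarged.
\<close>
lemma nearest_extend:
  assumes "R > 0" and "reach_at_least R K" and "nearest K x p"
    and "0 < dist x p" and "dist x p < R"
  shows "nearest K (p + (R / dist x p) *\<^sub>R (x - p)) p"
proof -
  define u where "u = (x - p) /\<^sub>R dist x p"
  have norm_u: "norm u = 1"
    using \<open>0 < dist x p\<close> by (simp add: u_def dist_norm)
  have "closed K" and "p \<in> K" and unp: "ball p R \<subseteq> Unp K"
    using assms by (auto simp: reach_at_least_iff nearest_def)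
  define S where "S = {0..R} \<inter> {t. nearest K (p + t *\<^sub>R u) p}"
  have "{t. nearest K (p + t *\<^sub>R u) p} = (\<Inter>k\<in>K. {t. dist (p + t *\<^sub>R u) p \<le> dist (p + t *\<^sub>R u) k})"
    using \<open>p \<in> K\<close> by (auto simp: nearest_def)
  moreover have "closed \<dots>"
    by (intro closed_INT ballI closed_Collect_le continuous_intros)
  ultimately have "compact S"
    unfolding S_def by (auto intro: compact_Int_closed)
  have "dist x p \<in> S"
    using assms by (auto simp: S_def u_def)
  with \<open>compact S\<close> obtain \<tau> where "\<tau> \<in> S" and max: "\<And>t. t \<in> S \<Longrightarrow> t \<le> \<tau>"
    using compact_attains_sup[of S] by blast
  define y where "y = p + \<tau> *\<^sub>R u"
  have "0 < \<tau>" "\<tau> \<le> R"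
    using max[OF \<open>dist x p \<in> S\<close>] \<open>\<tau> \<in> S\<close> less_le_trans[OF \<open>0 < dist x p\<close>] by (auto simp: S_def)
  have y: "nearest K y p"
    using \<open>\<tau> \<in> S\<close> by (simp add: S_def y_def)
  have dist_y: "dist p y = \<tau>"
    using \<open>0 < \<tau>\<close> by (simp add: y_def dist_norm norm_u)
  have "y \<notin> K"
    using y dist_y \<open>0 < \<tau>\<close> by (auto simp: nearest_def dist_commute)
  have "\<tau> = R"
  proof (rule ccontr)
    assume "\<tau> \<noteq> R"
    \<comment> \<open>Half the remaining gap keeps \<open>cball y \<epsilon>\<close> inside
      \<open>ball p R\<close>, where nearest points are unique.\<close>
    define \<epsilon> where "\<epsilon> = (R - \<tau>) / 2"
    have "0 < \<epsilon>" "\<tau> + \<epsilon> < R"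
      using \<open>\<tau> \<le> R\<close> \<open>\<tau> \<noteq> R\<close> by (auto simp: \<epsilon>_def field_simps)
    have cball: "cball y \<epsilon> \<subseteq> Unp K"
    proof
      fix z assume "z \<in> cball y \<epsilon>"
      then have "dist p z < R"
        using dist_triangle[of p z y] dist_y \<open>\<tau> + \<epsilon> < R\<close> by simp
      then show "z \<in> Unp K"
        using unp by auto
    qed
    then obtain f where f: "\<And>z. z \<in> cball y \<epsilon> \<Longrightarrow> nearest K z (f z)"
      unfolding subset_eq Unp_iff by metis
    have y_ne: "y \<noteq> f z" if "z \<in> cball y \<epsilon>" for z
      using f[OF that] \<open>y \<notin> K\<close> by (auto simp: nearest_def)
    define g where "g z = y + (\<epsilon> / norm (y - f z)) *\<^sub>R (y - f z)" for z
    have "continuous_on (cball y \<epsilon>) f"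
      by (rule continuous_on_nearest[OF \<open>closed K\<close> compact_cball f cball])
    then have "continuous_on (cball y \<epsilon>) g"
      unfolding g_def by (intro continuous_intros) (simp_all add: y_ne)
    moreover have "g \<in> cball y \<epsilon> \<rightarrow> cball y \<epsilon>"
      using \<open>0 < \<epsilon>\<close> by (auto simp: g_def dist_norm)
    ultimately obtain z where z: "z \<in> cball y \<epsilon>" "g z = z"
      by (rule brouwer_ball[OF \<open>0 < \<epsilon>\<close>])
    define q where "q = f z"
    define c where "c = \<epsilon> / norm (y - q)"
    have "norm (y - q) > 0"
      using y_ne[OF z(1)] by (simp add: q_def)
    then have "c > 0"
      using \<open>0 < \<epsilon>\<close> by (simp add: c_def)
    have z_eq: "z = y + c *\<^sub>R (y - q)"
      using z(2) by (simp add: g_def c_def q_def)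
    then have "z - q = (1 + c) *\<^sub>R (y - q)"
      by (simp add: algebra_simps)
    then have "norm (z - q) = (1 + c) * norm (y - q)"
      using \<open>c > 0\<close> by simp
    moreover have "norm (z - y) = c * norm (y - q)"
      using z_eq \<open>c > 0\<close> by simp
    \<comment> \<open>The fixed point equation puts \<open>y\<close> on the segment from
      \<open>q\<close> to \<open>z\<close>, so \<open>q\<close> is nearest to \<open>y\<close> as
      well and must be \<open>p\<close>.\<close>
    ultimately have "dist q z = dist q y + dist y z"
      by (simp add: dist_norm norm_minus_commute algebra_simps)
    then have "nearest K y q"
      using f[OF z(1)] nearest_between unfolding q_def by blast
    moreover have "y \<in> Unp K"
      using cball \<open>0 < \<epsilon>\<close> by auto
    ultimately have "q = p"
      using y unfolding Unp_iff by blast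
    then have "z = p + (\<tau> + \<epsilon>) *\<^sub>R u"
      using z_eq \<open>0 < \<tau>\<close> by (simp add: c_def y_def norm_u algebra_simps)
    then have "\<tau> + \<epsilon> \<in> S"
      using f[OF z(1)] \<open>q = p\<close> \<open>0 < \<tau>\<close> \<open>0 < \<epsilon>\<close> \<open>\<tau> + \<epsilon> < R\<close> by (simp add: S_def q_def)
    then show False
      using max \<open>0 < \<epsilon>\<close> by fastforce
  qed
  then show ?thesis
    using y by (simp add: y_def u_def divide_inverse)
qed

section \<open>Far sets of sets of reach at least \<open>R\<close>, and the hull\<close>

lemma far_set_point_beyond:
  assumes "R > 0" and "reach_at_least R K" and "x \<notin> K" and "x \<notin> far_set R K"
  obtains p y where "p \<in> K" and "y \<in> far_set R K" and "x \<noteq> p"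
    and "dist p x + dist x y = R" and "y = p + (R / dist x p) *\<^sub>R (x - p)"
proof -
  obtain a where "a \<in> K" "dist a x < R"
    using \<open>x \<notin> far_set R K\<close> by (auto simp: far_set_iff dist_commute not_le)
  then have "x \<in> Unp K"
    using assms(1,2) by (force simp: reach_at_least_iff)
  then obtain p where p: "nearest K x p"
    by (auto simp: Unp_iff)
  then have "p \<in> K" "dist x p < R" "x \<noteq> p"
    using \<open>a \<in> K\<close> \<open>dist a x < R\<close> \<open>x \<notin> K\<close>
    by (force simp: nearest_def dist_commute)+
  define y where "y = p + (R / dist x p) *\<^sub>R (x - p)"
  have y: "nearest K y p"
    unfolding y_def using assms(1,2) p \<open>x \<noteq> p\<close> \<open>dist x p < R\<close> by (intro nearest_extend) auto
  have "dist y p = R"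
    using \<open>R > 0\<close> \<open>x \<noteq> p\<close> by (simp add: y_def dist_norm)
  \<comment> \<open>The distance from \<open>y\<close> to \<open>K\<close> is attained at
    \<open>p\<close> and equals \<open>R\<close>.\<close>
  then have "y \<in> far_set R K"
    using y by (simp add: far_set_iff nearest_def)
  have "y - x = (R / dist x p - 1) *\<^sub>R (x - p)"
    by (simp add: y_def algebra_simps)
  moreover have "R / dist x p - 1 \<ge> 0"
    using \<open>dist x p < R\<close> \<open>x \<noteq> p\<close> by simp
  ultimately have "dist x y = (R / dist x p - 1) * dist x p"
    by (simp add: dist_norm norm_minus_commute[of x y])
  then have "dist p x + dist x y = R"
    using \<open>x \<noteq> p\<close> by (simp add: dist_commute algebra_simps)
  with that \<open>p \<in> K\<close> \<open>y \<in> far_set R K\<close> \<open>x \<noteq> p\<close> y_def show thesis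
    by blast
qed

lemma far_set_far_set_subset:
  assumes "R > 0" and "reach_at_least R K"
  shows "far_set R (far_set R K) \<subseteq> K"
proof
  fix x assume x: "x \<in> far_set R (far_set R K)"
  show "x \<in> K"
  proof (rule ccontr)
    assume "x \<notin> K"
    \<comment> \<open>Otherwise \<open>x\<close> would have distance at least \<open>R\<close> from
      itself.\<close>
    moreover have "x \<notin> far_set R K"
      using x \<open>R > 0\<close> unfolding far_set_iff[of x R "far_set R K"] by fastforce
    ultimately obtain p y where "y \<in> far_set R K" "x \<noteq> p" "dist p x + dist x y = R"
      using far_set_point_beyond[OF assms] by metis
    moreover from this have "R \<le> dist x y"
      using x by (simp add: far_set_iff)
    ultimately show False
      using dist_pos_lt[of p x] by auto
  qed
qed

lemma reach_at_least_far_set: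
  assumes "R > 0" and "reach_at_least R K"
  shows "reach_at_least R (far_set R K)"
  unfolding reach_at_least_iff[OF \<open>R > 0\<close>]
proof (intro conjI ballI subsetI closed_far_set)
  fix b x assume b: "b \<in> far_set R K" and x: "x \<in> ball b R"
  have "x \<notin> K"
    using b x by (auto simp: far_set_iff)
  show "x \<in> Unp (far_set R K)"
  proof (cases "x \<in> far_set R K")
    case True
    then show ?thesis
      unfolding Unp_iff nearest_def by (intro ex1I[of _ x]) auto
  next
    case False
    then obtain p y where p: "p \<in> K" "x \<noteq> p" and y: "y \<in> far_set R K"
      and R: "dist p x + dist x y = R" and y_eq: "y = p + (R / dist x p) *\<^sub>R (x - p)"
      using far_set_point_beyond[OF assms \<open>x \<notin> K\<close>] by metis
    have far: "R \<le> dist p z" if "z \<in> far_set R K" for z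
      using that p by (simp add: far_set_iff dist_commute)
    have near: "nearest (far_set R K) x y"
      unfolding nearest_def
    proof (intro conjI ballI y)
      fix z assume "z \<in> far_set R K"
      \<comment> \<open>Any path from \<open>p\<close> through \<open>x\<close> to a far point has
        length at least \<open>R\<close>, and the one ending at \<open>y\<close> has length exactly
        \<open>R\<close>.\<close>
      then show "dist x y \<le> dist x z"
        using far[of z] R dist_triangle[of p z x] by simp
    qed
    have "z = y" if z: "nearest (far_set R K) x z" for z
    proof -
      have "z \<in> far_set R K" "dist x z \<le> dist x y"
        using z y by (auto simp: nearest_def)
      then have "dist p z = R" and pz: "dist p z = dist p x + dist x z"
        using far[of z] R dist_triangle[of p z x] by auto
      \<comment> \<open>Equality in the triangle inequality makes \<open>z - x\<close> point along
        \<open>x - p\<close>; with its length known, this determines \<open>z\<close>.\<close>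
      have "norm (x - p) *\<^sub>R (z - x) = norm (z - x) *\<^sub>R (x - p)"
        using pz norm_triangle_eq[of "x - p" "z - x"] by (simp add: dist_norm norm_minus_commute)
      moreover have "norm (z - x) = R - norm (x - p)"
        using pz \<open>dist p z = R\<close> by (simp add: dist_norm norm_minus_commute)
      ultimately have "dist x p *\<^sub>R (z - p) = R *\<^sub>R (x - p)"
        by (simp add: dist_norm algebra_simps)
      then have "z - p = (R / dist x p) *\<^sub>R (x - p)"
        using \<open>x \<noteq> p\<close> by (simp add: eq_vector_fraction_iff)
      then show ?thesis
        by (simp add: y_eq algebra_simps)
    qed
    with near show ?thesis
      unfolding Unp_iff by blast
  qed
qed

theorem theorem4p4:
  fixes A :: "'a::euclidean_space set" and R :: real
  assumes "R > 0" and "reach_at_least R (far_set R A)"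
  shows "admits_R_hull R A \<and> R_hull R A = far_set R (far_set R A)"
proof -
  have "is_R_hull R A (far_set R (far_set R A))"
    unfolding is_R_hull_def
  proof (intro conjI allI impI subset_far_set_far_set)
    show "reach_at_least R (far_set R (far_set R A))"
      using assms by (rule reach_at_least_far_set)
  next
    \<comment> \<open>Two antitone steps preserve \<open>A \<subseteq> K\<close>, and the double far
      set of the competitor \<open>K\<close> lies in \<open>K\<close>.\<close>
    fix K :: "'a set" assume K: "reach_at_least R K \<and> A \<subseteq> K"
    then have "far_set R (far_set R A) \<subseteq> far_set R (far_set R K)"
      by (intro far_set_antimono) blast
    then show "far_set R (far_set R A) \<subseteq> K"
      using far_set_far_set_subset[OF assms(1), of K] K by blast
  qed
  then show ?thesis
    using R_hull_eqI unfolding admits_R_hull_def by metis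
qed

end
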